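(* Let $W=\tau_1XY+\tau_2YX+\tau_3X+\tau_4Y+\tau_0\mathcal{I}$ be the generic bilinear combination of $X$ and $Y$, with parameters $\tau_0,\dots,\tau_4$. Then $W=A_1(x)T^{+}+A_2(x)T^{-}+A_0(x)\mathcal{I}$ with $$A_1(x)=\frac{aq(x-1)(bx-c)\big((\tau_1+q\tau_2)x+\tau_4\big)}{x^2},\qquad A_2(x)=\frac{(x-aq)(x-cq)\big((\tau_1+q^{-1}\tau_2)x+\tau_4\big)}{x^2},$$ $$A_0(x)=-A_1(x)-A_2(x)+p_1(x),$$ $$p_1(x)=\big(\tau_2(q-1)(qab-q^{-1})+\tau_3\big)x+\tau_0+(1-q)\big(qa(b+c)-a-c\big)\tau_2 .$$ These coefficients have the same structure as those of the big q-Heun operator. Moreover, once a scaling $x\to\delta x$ of the argument is used to put one of the roots of the polynomial $p_3(x)$ of the big q-Heun operator equal to $1$, the coefficients $A_0,A_1,A_2$ above are the same as those of the big q-Heun operator: the polynomials $p_3(x),p_2(x),p_1(x)$ can be expressed in terms of the parameters $\tau_0,\dots,\tau_4$ and $a,b,c$, and vice versa. Thus the big q-Heun operator is characterized as the second-order q-difference operator given by the bilinear Ansatz $W=\tau_1XY+\tau_2YX+\tau_3X+\tau_4Y+\tau_0\mathcal{I}$. If $c=0$, the coefficients $A_i(x)$ become those of the little q-Heun operator.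
   Context: $q$ is the base parameter. $T^{+}f(x)=f(qx)$, $T^{-}f(x)=f(x/q)$, and $\mathcal{I}$ is the identity operator. $X$ is multiplication by $x$, and $Y$ is the q-difference operator of the big q-Jacobi polynomials with parameters $a,b,c$: $$Y=B(x)T^{+}+D(x)T^{-}-(B(x)+D(x))\mathcal{I},\quad B(x)=aq\,x^{-2}(x-1)(bx-c),\quad D(x)=x^{-2}(x-aq)(x-cq).$$ The big q-Heun operator is the operator $A_1(x)T^{+}+A_2(x)T^{-}+A_0(x)\mathcal{I}$ with $A_1=p_3/x^2$, $A_2=(q p_3+x p_2)/x^2$, $A_0=-A_1-A_2+p_1$, where $p_1,p_2,p_3$ are polynomials with $\deg p_i\le i$. The little q-Heun operator is the special case $p_3(0)=0$, i.e. $p_3(x)=x\,r_2(x)$ with $r_2$ a polynomial of second degree, so that $A_1=r_2/x$, $A_2=(q r_2+p_2)/x$, $A_0=-A_1-A_2+p_1$.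
   Formalization: Assumes q≠0, q²≠1. The "vice versa" is proved at a nonzero root δ of p3 only if R=qp3+xp2 is 0, or deg R≥2 and either p3=0 or R, p3 vanish to equal order at 0 and R is no monomial; otherwise (e.g. p3=x²(x−1), p2=1) it fails. *)

theory Defs
  imports Complex_Main "HOL-Computational_Algebra.Polynomial"
begin

text \<open>
  Operators act on functions \<open>complex \<Rightarrow> complex\<close>; their coefficients have poles at \<open>0\<close>, so
  identities between operators are only meaningful (and only claimed) at points \<open>x \<noteq> 0\<close>.
\<close>

type_synonym operator = "(complex \<Rightarrow> complex) \<Rightarrow> complex \<Rightarrow> complex"

definition Tplus :: "complex \<Rightarrow> operator" where
  "Tplus q f = (\<lambda>x. f (q * x))"

definition Tminus :: "complex \<Rightarrow> operator" where
  "Tminus q f = (\<lambda>x. f (x / q))"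

definition qdiff_op ::
  "complex \<Rightarrow> (complex \<Rightarrow> complex) \<Rightarrow> (complex \<Rightarrow> complex) \<Rightarrow> (complex \<Rightarrow> complex) \<Rightarrow> operator"
where
  "qdiff_op q A1 A2 A0 f = (\<lambda>x. A1 x * Tplus q f x + A2 x * Tminus q f x + A0 x * f x)"

definition X_op :: operator where
  "X_op f = (\<lambda>x. x * f x)"

definition qJacobi_B :: "complex \<Rightarrow> complex \<Rightarrow> complex \<Rightarrow> complex \<Rightarrow> complex \<Rightarrow> complex" where
  "qJacobi_B q a b c x = a * q * (x - 1) * (b * x - c) / x ^ 2"

definition qJacobi_D :: "complex \<Rightarrow> complex \<Rightarrow> complex \<Rightarrow> complex \<Rightarrow> complex" where
  "qJacobi_D q a c x = (x - a * q) * (x - c * q) / x ^ 2"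

definition Y_op :: "complex \<Rightarrow> complex \<Rightarrow> complex \<Rightarrow> complex \<Rightarrow> operator" where
  "Y_op q a b c =
     qdiff_op q (qJacobi_B q a b c) (qJacobi_D q a c)
       (\<lambda>x. - (qJacobi_B q a b c x + qJacobi_D q a c x))"

definition W_op ::
  "complex \<Rightarrow> complex \<Rightarrow> complex \<Rightarrow> complex \<Rightarrow>
   complex \<Rightarrow> complex \<Rightarrow> complex \<Rightarrow> complex \<Rightarrow> complex \<Rightarrow> operator"
where
  "W_op q a b c \<tau>0 \<tau>1 \<tau>2 \<tau>3 \<tau>4 f = (\<lambda>x.
     \<tau>1 * X_op (Y_op q a b c f) x + \<tau>2 * Y_op q a b c (X_op f) x
     + \<tau>3 * X_op f x + \<tau>4 * Y_op q a b c f x + \<tau>0 * f x)"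

definition W_A1 ::
  "complex \<Rightarrow> complex \<Rightarrow> complex \<Rightarrow> complex \<Rightarrow> complex \<Rightarrow> complex \<Rightarrow> complex \<Rightarrow> complex \<Rightarrow> complex"
where
  "W_A1 q a b c \<tau>1 \<tau>2 \<tau>4 x =
     a * q * (x - 1) * (b * x - c) * ((\<tau>1 + q * \<tau>2) * x + \<tau>4) / x ^ 2"

definition W_A2 ::
  "complex \<Rightarrow> complex \<Rightarrow> complex \<Rightarrow> complex \<Rightarrow> complex \<Rightarrow> complex \<Rightarrow> complex \<Rightarrow> complex"
where
  "W_A2 q a c \<tau>1 \<tau>2 \<tau>4 x =
     (x - a * q) * (x - c * q) * ((\<tau>1 + inverse q * \<tau>2) * x + \<tau>4) / x ^ 2"

definition W_p1 ::
  "complex \<Rightarrow> complex \<Rightarrow> complex \<Rightarrow> complex \<Rightarrow> complex \<Rightarrow> complex \<Rightarrow> complex \<Rightarrow> complex \<Rightarrow> complex"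
where
  "W_p1 q a b c \<tau>0 \<tau>2 \<tau>3 x =
     (\<tau>2 * (q - 1) * (q * a * b - inverse q) + \<tau>3) * x
     + \<tau>0 + (1 - q) * (q * a * (b + c) - a - c) * \<tau>2"

definition W_A0 ::
  "complex \<Rightarrow> complex \<Rightarrow> complex \<Rightarrow> complex \<Rightarrow>
   complex \<Rightarrow> complex \<Rightarrow> complex \<Rightarrow> complex \<Rightarrow> complex \<Rightarrow> complex \<Rightarrow> complex"
where
  "W_A0 q a b c \<tau>0 \<tau>1 \<tau>2 \<tau>3 \<tau>4 x =
     - W_A1 q a b c \<tau>1 \<tau>2 \<tau>4 x - W_A2 q a c \<tau>1 \<tau>2 \<tau>4 x + W_p1 q a b c \<tau>0 \<tau>2 \<tau>3 x"

definition big_A1 :: "complex poly \<Rightarrow> complex \<Rightarrow> complex" where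
  "big_A1 p3 x = poly p3 x / x ^ 2"

definition big_A2 :: "complex \<Rightarrow> complex poly \<Rightarrow> complex poly \<Rightarrow> complex \<Rightarrow> complex" where
  "big_A2 q p2 p3 x = (q * poly p3 x + x * poly p2 x) / x ^ 2"

definition big_A0 ::
  "complex \<Rightarrow> complex poly \<Rightarrow> complex poly \<Rightarrow> complex poly \<Rightarrow> complex \<Rightarrow> complex"
where
  "big_A0 q p1 p2 p3 x = - big_A1 p3 x - big_A2 q p2 p3 x + poly p1 x"

definition big_q_Heun ::
  "complex \<Rightarrow> complex poly \<Rightarrow> complex poly \<Rightarrow> complex poly \<Rightarrow> operator"
where
  "big_q_Heun q p1 p2 p3 = qdiff_op q (big_A1 p3) (big_A2 q p2 p3) (big_A0 q p1 p2 p3)"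

definition little_A1 :: "complex poly \<Rightarrow> complex \<Rightarrow> complex" where
  "little_A1 r2 x = poly r2 x / x"

definition little_A2 :: "complex \<Rightarrow> complex poly \<Rightarrow> complex poly \<Rightarrow> complex \<Rightarrow> complex" where
  "little_A2 q p2 r2 x = (q * poly r2 x + poly p2 x) / x"

definition little_A0 ::
  "complex \<Rightarrow> complex poly \<Rightarrow> complex poly \<Rightarrow> complex poly \<Rightarrow> complex \<Rightarrow> complex"
where
  "little_A0 q p1 p2 r2 x = - little_A1 r2 x - little_A2 q p2 r2 x + poly p1 x"

definition little_q_Heun ::
  "complex \<Rightarrow> complex poly \<Rightarrow> complex poly \<Rightarrow> complex poly \<Rightarrow> operator"
where
  "little_q_Heun q p1 p2 r2 = qdiff_op q (little_A1 r2) (little_A2 q p2 r2) (little_A0 q p1 p2 r2)"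

text \<open>
  The substitution \<open>x \<rightarrow> \<delta> x\<close> turns an operator \<open>L\<close> into \<open>S L S\<^sup>-\<^sup>1\<close> with \<open>(S f) x = f (\<delta> x)\<close>;
  on q-difference operators it replaces every coefficient \<open>A x\<close> by \<open>A (\<delta> x)\<close>.
\<close>

definition scale_op :: "complex \<Rightarrow> operator \<Rightarrow> operator" where
  "scale_op \<delta> L f = (\<lambda>x. L (\<lambda>y. f (y / \<delta>)) (\<delta> * x))"

text \<open>
  \<open>R\<close> is the numerator of \<open>A\<^sub>2 = R / x\<^sup>2\<close> in the big q-Heun operator.  The Ansatz gives
  \<open>R = (x - aq)(x - cq)((\<tau>\<^sub>1 + \<tau>\<^sub>2/q) x + \<tau>\<^sub>4)\<close> and \<open>p\<^sub>3 = aq (x - 1)(bx - c)((\<tau>\<^sub>1 + q \<tau>\<^sub>2) x + \<tau>\<^sub>4)\<close>,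
  so a nonzero \<open>R\<close> has degree at least 2 and, unless \<open>p\<^sub>3 = 0\<close>, it has the nonzero root \<open>aq\<close>
  and the same multiplicity at \<open>0\<close> as \<open>p\<^sub>3\<close>.  Polynomials violating this are not reached
  by the Ansatz for any choice of parameters; a generic big q-Heun operator has
  \<open>degree R = 3\<close> and \<open>p\<^sub>3(0) \<noteq> 0\<close>, hence both multiplicities at \<open>0\<close> equal to \<open>0\<close>.
\<close>

definition nondegenerate :: "complex \<Rightarrow> complex poly \<Rightarrow> complex poly \<Rightarrow> bool" where
  "nondegenerate q p2 p3 \<longleftrightarrow>
     (let R = smult q p3 + pCons 0 p2 in
        R = 0 \<or>
        degree R \<ge> 2 \<and> (p3 = 0 \<or> order 0 R = order 0 p3 \<and> order 0 R < degree R))"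

end

theory Submission
  imports Defs "HOL-Computational_Algebra.Fundamental_Theorem_Algebra"
begin

text \<open>
  Composing \<open>Y\<close> with \<open>X\<close> on either side only multiplies the coefficients \<open>B\<close>, \<open>D\<close>, \<open>-B - D\<close> by
  \<open>x\<close>, \<open>q x\<close> or \<open>x / q\<close>.  Hence \<open>W\<close> is a second-order q-difference operator, and the sum of its
  three coefficients is \<open>\<tau>\<^sub>2 (q - 1) (x B - x D / q) + \<tau>\<^sub>3 x + \<tau>\<^sub>0\<close>; this is a polynomial because
  the residues of \<open>q x B\<close> and \<open>x D\<close> at \<open>0\<close> are both \<open>a c q\<^sup>2\<close>.  The same coincidence gives
  \<open>A\<^sub>2 - q A\<^sub>1\<close> at most a simple pole, which is what the big q-Heun form asks for.

  For the converse, let \<open>R = q p\<^sub>3 + x p\<^sub>2\<close> be the numerator of \<open>A\<^sub>2\<close>.  The parameters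
  \<open>\<tau>\<^sub>1 + q \<tau>\<^sub>2\<close> and \<open>\<tau>\<^sub>1 + \<tau>\<^sub>2 / q\<close> are independent since \<open>q\<^sup>2 \<noteq> 1\<close>, and \<open>\<tau>\<^sub>0\<close>, \<open>\<tau>\<^sub>3\<close> adjust \<open>p\<^sub>1\<close>
  freely.  What has to be solved is the simultaneous factorization
  \<open>R = (y - A) (y - C) (\<beta> y + \<tau>)\<close>, \<open>p\<^sub>3 = (A / \<delta>) (y - \<delta>) (b y - C / q) (\<alpha> y + \<tau>)\<close>
  in the unscaled variable \<open>y = \<delta> x\<close> (lemma \<open>joint_factorization\<close>).  Dividing \<open>R\<close> by a linear
  factor at a nonzero root \<open>A\<close> and \<open>p\<^sub>3\<close> by \<open>(A / \<delta>) (y - \<delta>)\<close> leaves two quadratics \<open>T\<close> and \<open>Q\<close>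
  with \<open>T(0) = q Q(0)\<close>, to be split as \<open>(y - C) (\<beta> y + \<tau>)\<close> and \<open>(b y - C / q) (\<alpha> y + \<tau>)\<close>.
  A splitting of \<open>T\<close> fixes \<open>C\<close> and \<open>\<tau>\<close>, that is, the values at \<open>0\<close> of both factors of \<open>Q\<close>.  Linear
  factors of \<open>Q\<close> can be rescaled to these values if they vanish at \<open>0\<close> exactly when prescribed;
  equality of the orders at \<open>0\<close> guarantees this (lemma \<open>split_with_matching_constants\<close>).
\<close>

section \<open>The q-difference form of the bilinear Ansatz\<close>

lemma W_op_eq_qdiff_op:
  assumes "q \<noteq> 0" "x \<noteq> 0"
  shows "W_op q a b c \<tau>0 \<tau>1 \<tau>2 \<tau>3 \<tau>4 f x =
    qdiff_op q (W_A1 q a b c \<tau>1 \<tau>2 \<tau>4) (W_A2 q a c \<tau>1 \<tau>2 \<tau>4) (W_A0 q a b c \<tau>0 \<tau>1 \<tau>2 \<tau>3 \<tau>4) f x"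
proof -
  define B where "B = qJacobi_B q a b c x"
  define D where "D = qJacobi_D q a c x"
  have A1: "W_A1 q a b c \<tau>1 \<tau>2 \<tau>4 x = B * ((\<tau>1 + q * \<tau>2) * x + \<tau>4)"
    by (simp add: W_A1_def B_def qJacobi_B_def)
  have A2: "W_A2 q a c \<tau>1 \<tau>2 \<tau>4 x = D * ((\<tau>1 + inverse q * \<tau>2) * x + \<tau>4)"
    by (simp add: W_A2_def D_def qJacobi_D_def)
  \<comment> \<open>The poles of the two terms cancel here.\<close>
  have "q * (x * B) - x * D = (q * (q * a * b) - 1) * x - q * (q * a * (b + c) - a - c)"
    using assms by (simp add: B_def D_def qJacobi_B_def qJacobi_D_def field_simps power2_eq_square)
  then have BD: "x * B - x * D * inverse q = (q * a * b - inverse q) * x - (q * a * (b + c) - a - c)"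
    using assms by (simp add: field_simps)
  have "W_p1 q a b c \<tau>0 \<tau>2 \<tau>3 x =
      \<tau>2 * (q - 1) * ((q * a * b - inverse q) * x - (q * a * (b + c) - a - c)) + \<tau>3 * x + \<tau>0"
    by (simp add: W_p1_def algebra_simps)
  then have p1: "W_p1 q a b c \<tau>0 \<tau>2 \<tau>3 x =
      \<tau>2 * (q - 1) * (x * B - x * D * inverse q) + \<tau>3 * x + \<tau>0"
    by (simp only: BD)
  have A0: "W_A0 q a b c \<tau>0 \<tau>1 \<tau>2 \<tau>3 \<tau>4 x =
      - (B + D) * ((\<tau>1 + \<tau>2) * x + \<tau>4) + \<tau>3 * x + \<tau>0"
    unfolding W_A0_def A1 A2 p1 using assms(1) by (simp add: field_simps)
  show ?thesis
    unfolding W_op_def Y_op_def X_op_def qdiff_op_def A0 A1 A2 Tplus_def Tminus_def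
      B_def [symmetric] D_def [symmetric]
    using assms(1) by (simp add: field_simps)
qed

section \<open>Bilinear operators are q-Heun operators\<close>

lemma W_coefficients_big_q_Heun:
  fixes q a b c \<tau>0 \<tau>1 \<tau>2 \<tau>3 \<tau>4 :: complex
  assumes "q \<noteq> 0"
  obtains p1 p2 p3 where "degree p1 \<le> 1" "degree p2 \<le> 2" "degree p3 \<le> 3" "poly p3 1 = 0"
    "poly p3 0 = a * c * q * \<tau>4"
    "\<And>x. x \<noteq> 0 \<Longrightarrow> W_A1 q a b c \<tau>1 \<tau>2 \<tau>4 x = big_A1 p3 x"
    "\<And>x. x \<noteq> 0 \<Longrightarrow> W_A2 q a c \<tau>1 \<tau>2 \<tau>4 x = big_A2 q p2 p3 x"
    "\<And>x. x \<noteq> 0 \<Longrightarrow> W_A0 q a b c \<tau>0 \<tau>1 \<tau>2 \<tau>3 \<tau>4 x = big_A0 q p1 p2 p3 x"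
proof -
  define \<alpha> where "\<alpha> = \<tau>1 + q * \<tau>2"
  define \<beta> where "\<beta> = \<tau>1 + inverse q * \<tau>2"
  define p1 where "p1 = [:\<tau>0 + (1 - q) * (q * a * (b + c) - a - c) * \<tau>2,
    \<tau>2 * (q - 1) * (q * a * b - inverse q) + \<tau>3:]"
  define p3 where "p3 = smult (a * q) ([:-1, 1:] * [:-c, b:] * [:\<tau>4, \<alpha>:])"
  define R where "R = [:-(a * q), 1:] * [:-(c * q), 1:] * [:\<tau>4, \<beta>:]"
  define N where "N = R - smult q p3"
  have deg: "degree p3 \<le> 3" "degree R \<le> 3"
    unfolding p3_def R_def by (auto simp: degree_pCons_eq_if)
  then have degN: "degree N \<le> 3"
    unfolding N_def by (intro degree_diff_le) auto
  \<comment> \<open>\<open>R(0) = a c q\<^sup>2 \<tau>\<^sub>4 = q p\<^sub>3(0)\<close>, so that \<open>N\<close> is divisible by \<open>x\<close>.\<close>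
  have "poly N 0 = 0"
    by (simp add: N_def R_def p3_def)
  then obtain p2 where p2: "N = pCons 0 p2"
    by (cases N) auto
  have degp2: "degree p2 \<le> 2"
    using degN by (auto simp: p2 degree_pCons_eq_if split: if_splits)
  have R: "R = smult q p3 + pCons 0 p2"
    unfolding p2 [symmetric] N_def by simp
  have A1: "W_A1 q a b c \<tau>1 \<tau>2 \<tau>4 x = big_A1 p3 x" for x
    unfolding W_A1_def big_A1_def p3_def \<alpha>_def by (simp add: algebra_simps)
  have A2: "W_A2 q a c \<tau>1 \<tau>2 \<tau>4 x = big_A2 q p2 p3 x" for x
  proof -
    have "q * poly p3 x + x * poly p2 x = poly R x"
      by (simp add: R)
    then show ?thesis
      by (simp add: W_A2_def big_A2_def R_def \<beta>_def algebra_simps)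
  qed
  have p1: "poly p1 x = W_p1 q a b c \<tau>0 \<tau>2 \<tau>3 x" for x
    by (simp add: p1_def W_p1_def algebra_simps)
  show ?thesis
  proof (rule that[of p1 p2 p3])
    show "W_A0 q a b c \<tau>0 \<tau>1 \<tau>2 \<tau>3 \<tau>4 x = big_A0 q p1 p2 p3 x" for x
      by (simp add: W_A0_def big_A0_def A1 A2 p1)
    show "degree p1 \<le> 1" by (simp add: p1_def)
    show "poly p3 1 = 0" "poly p3 0 = a * c * q * \<tau>4"
      unfolding p3_def poly_smult poly_mult by simp_all
  qed (use deg degp2 A1 A2 in auto)
qed

text \<open>A root of \<open>p\<^sub>3\<close> at \<open>0\<close> cancels one power of \<open>x\<close> in the denominators of \<open>A\<^sub>1\<close> and \<open>A\<^sub>2\<close>.\<close>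

lemma big_q_Heun_coefficients_little:
  assumes "x \<noteq> 0"
  shows "big_A1 (pCons 0 r2) x = little_A1 r2 x"
    and "big_A2 q p2 (pCons 0 r2) x = little_A2 q p2 r2 x"
    and "big_A0 q p1 p2 (pCons 0 r2) x = little_A0 q p1 p2 r2 x"
proof -
  show 1: "big_A1 (pCons 0 r2) x = little_A1 r2 x"
    using assms by (simp add: big_A1_def little_A1_def power2_eq_square)
  show 2: "big_A2 q p2 (pCons 0 r2) x = little_A2 q p2 r2 x"
    using assms by (simp add: big_A2_def little_A2_def power2_eq_square field_simps)
  show "big_A0 q p1 p2 (pCons 0 r2) x = little_A0 q p1 p2 r2 x"
    by (simp add: big_A0_def little_A0_def 1 2)
qed

section \<open>Splitting quadratic polynomials over the complex numbers\<close>

lemma complex_poly_root_exists: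
  fixes p :: "complex poly"
  assumes "degree p > 0"
  shows "\<exists>z. poly p z = 0"
  using assms fundamental_theorem_of_algebra[of p] by (simp add: constant_degree)

lemma poly_eq_pCons_if_degree_le_1:
  fixes p :: "'a::zero poly"
  assumes "degree p \<le> 1"
  obtains u v where "p = [:u, v:]"
proof (cases p)
  case (pCons u p')
  then have "degree p' = 0"
    using assms by (auto simp: degree_pCons_eq_if split: if_splits)
  then show ?thesis
    using pCons that by (metis degree_eq_zeroE)
qed

lemma factor_root:
  fixes p :: "'a::idom poly"
  assumes "poly p z = 0" "p \<noteq> 0"
  obtains u where "p = [:-z, 1:] * u" "degree p = Suc (degree u)"
proof -
  obtain u where u: "p = [:-z, 1:] * u"
    using assms(1) by (auto simp: poly_eq_0_iff_dvd)
  with assms(2) have "u \<noteq> 0" by auto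
  then have "degree p = Suc (degree u)"
    unfolding u by (subst degree_mult_eq) auto
  with u show ?thesis using that by blast
qed

lemma nonzero_root_exists:
  fixes p :: "complex poly"
  assumes "p \<noteq> 0" "order 0 p < degree p"
  shows "\<exists>z. z \<noteq> 0 \<and> poly p z = 0"
proof -
  obtain u where u: "p = [:- 0, 1:] ^ order 0 p * u" "\<not> [:- 0, 1:] dvd u"
    using order_decomp[OF assms(1), of 0] by blast
  then have "u \<noteq> 0" by auto
  then have "degree p = order 0 p + degree u"
    by (subst u(1)) (simp add: degree_mult_eq degree_power_eq)
  then obtain z where "poly u z = 0"
    using assms(2) complex_poly_root_exists[of u] by auto
  moreover from this u(2) have "z \<noteq> 0"
    by (auto simp: poly_eq_0_iff_dvd)
  ultimately show ?thesis
    by (subst u(1)) auto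
qed

text \<open>
  When \<open>T(0) = 0\<close>, the root \<open>t = 0\<close> is split off first.  Then \<open>\<tau>\<close> vanishes only for a double root
  at \<open>0\<close>, so that \<open>t\<close> and \<open>\<tau>\<close> encode the order of \<open>T\<close> at \<open>0\<close>.
\<close>

lemma split_quadratic:
  fixes T :: "complex poly"
  assumes "0 < degree T" "degree T \<le> 2"
  obtains t \<tau> \<beta> where "T = [:-t, 1:] * [:\<tau>, \<beta>:]" "poly T 0 = 0 \<Longrightarrow> t = 0"
proof -
  obtain t where t: "poly T t = 0" "poly T 0 = 0 \<Longrightarrow> t = 0"
    using complex_poly_root_exists[OF assms(1)] by (cases "poly T 0 = 0") auto
  have "T \<noteq> 0" using assms(1) by auto
  then obtain U where U: "T = [:-t, 1:] * U" "degree T = Suc (degree U)"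
    using factor_root t(1) by blast
  then obtain \<tau> \<beta> where "U = [:\<tau>, \<beta>:]"
    using assms(2) poly_eq_pCons_if_degree_le_1[of U] by auto
  then show ?thesis using that U(1) t(2) by blast
qed

text \<open>
  The values at \<open>0\<close> of the two linear factors of \<open>Q\<close> are prescribed by \<open>T\<close>.  If \<open>Q(0) \<noteq> 0\<close>, a root
  \<open>z\<close> of \<open>Q\<close> gives the factor \<open>-(\<tau> / z) (y - z)\<close>, and the cofactor then has the right value
  because the product does.  If \<open>T(0) = Q(0) = 0\<close>, one factor is a multiple of \<open>y\<close> and the other has
  the value \<open>\<tau>\<close> at \<open>0\<close>, which is possible if \<open>\<tau> = 0\<close> exactly when \<open>y\<^sup>2\<close> divides \<open>Q\<close>.
\<close>

lemma split_with_matching_constants: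
  fixes Q :: "complex poly"
  assumes "q \<noteq> 0" "Q \<noteq> 0" "T \<noteq> 0" "degree Q \<le> 2"
    and T: "T = [:-t, 1:] * [:\<tau>, \<beta>:]" "poly T 0 = 0 \<Longrightarrow> t = 0"
    and const: "poly T 0 = q * poly Q 0" and order: "order 0 Q = order 0 T"
  obtains b \<alpha> where "Q = [:- t / q, b:] * [:\<tau>, \<alpha>:]"
proof (cases "poly T 0 = 0")
  case False
  then have nz: "t \<noteq> 0" "\<tau> \<noteq> 0" "poly Q 0 \<noteq> 0"
    using T const by auto
  have Q0: "q * poly Q 0 = - t * \<tau>"
    using const by (simp add: T(1) mult.commute)
  show ?thesis
  proof (cases "degree Q = 0")
    case True
    then obtain k where k: "Q = [:k:]" by (rule degree_eq_zeroE)
    then have "Q = [:- t / q, 0:] * [:\<tau>, 0:]"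
      using Q0 assms(1) by (simp add: field_simps)
    then show ?thesis by (rule that)
  next
    case False
    then obtain z where z: "poly Q z = 0"
      using complex_poly_root_exists by blast
    have "z \<noteq> 0" using z nz by auto
    obtain U where U: "Q = [:-z, 1:] * U" "degree Q = Suc (degree U)"
      using factor_root z assms(2) by blast
    then obtain u v where uv: "U = [:u, v:]"
      using assms(4) poly_eq_pCons_if_degree_le_1[of U] by auto
    have "q * (z * u) = t * \<tau>"
      using Q0 by (simp add: U(1) uv mult.commute)
    then have "u = t * \<tau> / (q * z)"
      using assms(1) \<open>z \<noteq> 0\<close> by (simp add: field_simps)
    then have "Q = [:- t / q, - (z * v / \<tau>):] * [:\<tau>, - \<tau> / z:]"
      unfolding U uv using nz \<open>z \<noteq> 0\<close> assms(1) by (simp add: field_simps)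
    then show ?thesis by (rule that)
  qed
next
  case True
  then have "t = 0" "poly Q 0 = 0"
    using T const assms(1) by auto
  obtain U where U: "Q = [:-0, 1:] * U" "degree Q = Suc (degree U)"
    using factor_root \<open>poly Q 0 = 0\<close> assms(2) by blast
  then obtain l m where lm: "U = [:l, m:]"
    using assms(4) poly_eq_pCons_if_degree_le_1[of U] by auto
  have "order 0 Q = order 0 [:-0, 1::complex:] + order 0 U"
    using U(1) assms(2) order_mult[of "[:-0, 1:]" U 0] by simp
  moreover have "order 0 T = order 0 [:-0, 1::complex:] + order 0 [:\<tau>, \<beta>:]"
    using T(1) \<open>t = 0\<close> assms(3) order_mult[of "[:-0, 1:]" "[:\<tau>, \<beta>:]" 0] by simp
  ultimately have "order 0 U = order 0 [:\<tau>, \<beta>:]"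
    using order by simp
  moreover have "U \<noteq> 0" "[:\<tau>, \<beta>:] \<noteq> 0"
    using U(1) assms(2,3) T(1) by auto
  ultimately have "poly U 0 = 0 \<longleftrightarrow> poly [:\<tau>, \<beta>:] 0 = 0"
    by (metis order_root)
  then have l: "l = 0 \<longleftrightarrow> \<tau> = 0" by (simp add: lm)
  show ?thesis
  proof (cases "\<tau> = 0")
    case True
    then have "Q = [:- t / q, m:] * [:\<tau>, 1:]"
      using l by (simp add: U(1) lm \<open>t = 0\<close>)
    then show ?thesis by (rule that)
  next
    case False
    then have "Q = [:- t / q, l / \<tau>:] * [:\<tau>, m * \<tau> / l:]"
      using l by (simp add: U(1) lm \<open>t = 0\<close>)
    then show ?thesis by (rule that)
  qed
qed

section \<open>Simultaneous factorization of the two numerators\<close>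

text \<open>
  The choices \<open>\<beta> = \<tau> = 0\<close> and \<open>A = 0\<close> deal with \<open>R = 0\<close> and with \<open>P = 0\<close>, where the other polynomial
  vanishes at \<open>0\<close> and is split independently.  Otherwise \<open>A\<close> has to be a nonzero root of \<open>R\<close>, which
  exists because \<open>R\<close> is not a constant times a power of \<open>y\<close>.
\<close>

lemma joint_factorization:
  fixes P R :: "complex poly"
  assumes "q \<noteq> 0" "\<delta> \<noteq> 0" and deg: "degree P \<le> 3" "degree R \<le> 3"
    and "poly P \<delta> = 0" and const: "poly R 0 = q * poly P 0"
    and nondeg: "R = 0 \<or> degree R \<ge> 2 \<and> (P = 0 \<or> order 0 R = order 0 P \<and> order 0 R < degree R)"
  obtains A C b \<alpha> \<beta> \<tau> where
    "P = smult (A / \<delta>) ([:-\<delta>, 1:] * [:- C / q, b:] * [:\<tau>, \<alpha>:])"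
    "R = [:-A, 1:] * [:-C, 1:] * [:\<tau>, \<beta>:]"
proof -
  consider "R = 0" "P = 0" | "R = 0" "P \<noteq> 0" | "R \<noteq> 0" "P = 0" | "R \<noteq> 0" "P \<noteq> 0"
    by blast
  then show ?thesis
  proof cases
    case 1
    then show ?thesis
      by (intro that[of 0 0 0 0 0 0]) auto
  next
    case 2
    then have "poly P 0 = 0" using const assms(1) by simp
    obtain Q where Q: "P = [:-\<delta>, 1:] * Q" "degree P = Suc (degree Q)"
      using factor_root assms(5) 2 by blast
    then have "poly Q 0 = 0" "Q \<noteq> 0"
      using \<open>poly P 0 = 0\<close> assms(2) 2 by auto
    then obtain U where U: "Q = [:-0, 1:] * U" "degree Q = Suc (degree U)"
      using factor_root by blast
    then obtain l m where lm: "U = [:l, m:]"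
      using deg Q poly_eq_pCons_if_degree_le_1[of U] by auto
    show ?thesis
    proof (rule that[of \<delta> "- q * l" m 0 1 0])
      show "P = smult (\<delta> / \<delta>) ([:-\<delta>, 1:] * [:- (- q * l) / q, m:] * [:0, 1:])"
        unfolding Q U lm using assms(1,2) by simp
      show "R = [:-\<delta>, 1:] * [:- (- q * l), 1:] * [:0, 0:]"
        using 2 by simp
    qed
  next
    case 3
    then have "poly R 0 = 0" using const by simp
    then obtain T where T: "R = [:-0, 1:] * T" "degree R = Suc (degree T)"
      using factor_root 3 by blast
    moreover have "degree R \<ge> 2" using nondeg 3 by blast
    ultimately have "0 < degree T" "degree T \<le> 2" using deg by auto
    then obtain t \<tau> \<beta> where "T = [:-t, 1:] * [:\<tau>, \<beta>:]"
      using split_quadratic by blast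
    then show ?thesis
      using 3 by (intro that[of 0 t 0 \<tau> 0 \<beta>]) (simp_all add: T(1))
  next
    case 4
    then have ord: "order 0 R = order 0 P" "order 0 R < degree R" "degree R \<ge> 2"
      using nondeg by auto
    obtain A where A: "A \<noteq> 0" "poly R A = 0"
      using nonzero_root_exists[OF 4(1) ord(2)] by blast
    obtain T where T: "R = [:-A, 1:] * T" "degree R = Suc (degree T)"
      using factor_root A(2) 4(1) by blast
    obtain Q' where Q': "P = [:-\<delta>, 1:] * Q'" "degree P = Suc (degree Q')"
      using factor_root assms(5) 4(2) by blast
    define Q where "Q = smult (\<delta> / A) Q'"
    have P: "P = smult (A / \<delta>) ([:-\<delta>, 1:] * Q)"
      unfolding Q_def Q'(1) using A(1) assms(2) by simp
    have nz: "T \<noteq> 0" "Q \<noteq> 0"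
      using T(1) P 4 by auto
    have "0 < degree T" "degree T \<le> 2" using T(2) ord(3) deg by auto
    then obtain t \<tau> \<beta> where sT: "T = [:-t, 1:] * [:\<tau>, \<beta>:]" "poly T 0 = 0 \<Longrightarrow> t = 0"
      using split_quadratic by blast
    have "degree Q \<le> 2" using Q'(2) deg by (simp add: Q_def)
    \<comment> \<open>The factors split off do not vanish at \<open>0\<close>, so they do not affect the orders there.\<close>
    have "order 0 R = order 0 [:-A, 1:] + order 0 T"
      using order_mult[of "[:-A, 1:]" T 0] 4(1) unfolding T(1) by blast
    moreover have "order 0 P = order 0 ([:-\<delta>, 1:] * Q)"
      unfolding P using A(1) assms(2) by (intro order_smult) auto
    moreover have "order 0 ([:-\<delta>, 1:] * Q) = order 0 [:-\<delta>, 1:] + order 0 Q"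
      by (intro order_mult) (use 4(2) P in force)
    moreover have "order 0 [:-A, 1:] = 0" "order 0 [:-\<delta>, 1:] = 0"
      using A(1) assms(2) by (auto intro!: order_0I)
    ultimately have "order 0 Q = order 0 T" using ord(1) by simp
    moreover have "poly T 0 = q * poly Q 0"
      using const A(1) assms(2) unfolding T(1) P by (simp add: field_simps)
    ultimately obtain b \<alpha> where "Q = [:- t / q, b:] * [:\<tau>, \<alpha>:]"
      using split_with_matching_constants[OF assms(1) nz(2,1) \<open>degree Q \<le> 2\<close> sT] by blast
    then show ?thesis
      using that[of A t b \<tau> \<alpha> \<beta>] P T(1) sT(1) by (simp only: mult.assoc)
  qed
qed

section \<open>Big q-Heun operators are bilinear operators\<close>

lemma big_q_Heun_coefficients_W:
  fixes q \<delta> :: complex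
  assumes "q \<noteq> 0" "q ^ 2 \<noteq> 1" "\<delta> \<noteq> 0"
    and "degree p1 \<le> 1" "degree p2 \<le> 2" "degree p3 \<le> 3"
    and "poly p3 \<delta> = 0" "nondegenerate q p2 p3"
  obtains a b c \<tau>0 \<tau>1 \<tau>2 \<tau>3 \<tau>4 where
    "\<And>x. x \<noteq> 0 \<Longrightarrow> big_A1 p3 (\<delta> * x) = W_A1 q a b c \<tau>1 \<tau>2 \<tau>4 x"
    "\<And>x. x \<noteq> 0 \<Longrightarrow> big_A2 q p2 p3 (\<delta> * x) = W_A2 q a c \<tau>1 \<tau>2 \<tau>4 x"
    "\<And>x. x \<noteq> 0 \<Longrightarrow> big_A0 q p1 p2 p3 (\<delta> * x) = W_A0 q a b c \<tau>0 \<tau>1 \<tau>2 \<tau>3 \<tau>4 x"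
proof -
  define R where "R = smult q p3 + pCons 0 p2"
  have degR: "degree R \<le> 3"
    unfolding R_def using assms by (intro degree_add_le) (auto simp: degree_pCons_eq_if)
  have const: "poly R 0 = q * poly p3 0"
    by (simp add: R_def)
  have nondeg: "R = 0 \<or> degree R \<ge> 2 \<and> (p3 = 0 \<or> order 0 R = order 0 p3 \<and> order 0 R < degree R)"
    using assms(8) by (simp add: nondegenerate_def R_def Let_def)
  obtain A C b \<alpha> \<beta> \<tau> where
    p3: "p3 = smult (A / \<delta>) ([:-\<delta>, 1:] * [:- C / q, b:] * [:\<tau>, \<alpha>:])" and
    R: "R = [:-A, 1:] * [:-C, 1:] * [:\<tau>, \<beta>:]"
    by (rule joint_factorization[OF assms(1,3,6) degR assms(7) const nondeg])
  obtain u v where p1: "p1 = [:u, v:]"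
    using assms(4) by (rule poly_eq_pCons_if_degree_le_1)
  define a where "a = A / (\<delta> * q)"
  define c where "c = C / (\<delta> * q)"
  \<comment> \<open>The solution of \<open>\<tau>\<^sub>1 + q \<tau>\<^sub>2 = \<alpha> \<delta>\<close> and \<open>\<tau>\<^sub>1 + \<tau>\<^sub>2 / q = \<beta> \<delta>\<close>, by Cramer's rule.\<close>
  define \<tau>2 where "\<tau>2 = q * (\<alpha> - \<beta>) * \<delta> / (q ^ 2 - 1)"
  define \<tau>1 where "\<tau>1 = \<alpha> * \<delta> - q * \<tau>2"
  define \<tau>3 where "\<tau>3 = v * \<delta> - \<tau>2 * (q - 1) * (q * a * b - inverse q)"
  define \<tau>0 where "\<tau>0 = u - (1 - q) * (q * a * (b + c) - a - c) * \<tau>2"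
  have A: "A = a * q * \<delta>" and C: "C = c * q * \<delta>"
    using assms(1,3) by (simp_all add: a_def c_def)
  have \<alpha>: "\<tau>1 + q * \<tau>2 = \<alpha> * \<delta>"
    by (simp add: \<tau>1_def)
  have "(q ^ 2 - 1) * \<tau>2 = q * (\<alpha> - \<beta>) * \<delta>"
    using assms(2) by (simp add: \<tau>2_def)
  then have "q * (\<tau>1 + inverse q * \<tau>2) = q * (\<beta> * \<delta>)"
    using assms(1) by (simp add: \<tau>1_def power2_eq_square algebra_simps)
  then have \<beta>: "\<tau>1 + inverse q * \<tau>2 = \<beta> * \<delta>"
    using assms(1) by simp
  have A1: "big_A1 p3 (\<delta> * x) = W_A1 q a b c \<tau>1 \<tau>2 \<tau> x" if "x \<noteq> 0" for x
  proof -
    have "poly p3 (\<delta> * x) = \<delta> ^ 2 * (a * q * (x - 1) * (b * x - c) * (\<alpha> * \<delta> * x + \<tau>))"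
      unfolding p3 A C using assms(1,3) by (simp add: power2_eq_square algebra_simps)
    then show ?thesis
      unfolding big_A1_def W_A1_def \<alpha> using assms(3) by (simp add: power_mult_distrib)
  qed
  have A2: "big_A2 q p2 p3 (\<delta> * x) = W_A2 q a c \<tau>1 \<tau>2 \<tau> x" if "x \<noteq> 0" for x
  proof -
    have "q * poly p3 (\<delta> * x) + \<delta> * x * poly p2 (\<delta> * x) = poly R (\<delta> * x)"
      by (simp add: R_def)
    also have "\<dots> = \<delta> ^ 2 * ((x - a * q) * (x - c * q) * (\<beta> * \<delta> * x + \<tau>))"
      unfolding R A C by (simp add: power2_eq_square algebra_simps)
    finally show ?thesis
      unfolding big_A2_def W_A2_def \<beta> using assms(3) by (simp add: power_mult_distrib)
  qed
  have "poly p1 (\<delta> * x) = W_p1 q a b c \<tau>0 \<tau>2 \<tau>3 x" for x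
    by (simp add: p1 W_p1_def \<tau>3_def \<tau>0_def algebra_simps)
  then have "big_A0 q p1 p2 p3 (\<delta> * x) = W_A0 q a b c \<tau>0 \<tau>1 \<tau>2 \<tau>3 \<tau> x" if "x \<noteq> 0" for x
    using that by (simp add: big_A0_def W_A0_def A1 A2)
  then show ?thesis using that A1 A2 by blast
qed

lemma scale_op_qdiff_op:
  assumes "\<delta> \<noteq> 0"
  shows "scale_op \<delta> (qdiff_op q A1 A2 A0) f x =
    qdiff_op q (\<lambda>x. A1 (\<delta> * x)) (\<lambda>x. A2 (\<delta> * x)) (\<lambda>x. A0 (\<delta> * x)) f x"
  using assms by (simp add: scale_op_def qdiff_op_def Tplus_def Tminus_def)

section \<open>The characterization\<close>

theorem mainTheorem2:
  fixes q :: complex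
  assumes "q \<noteq> 0" and "q ^ 2 \<noteq> 1"
  shows
    "(\<forall>a b c \<tau>0 \<tau>1 \<tau>2 \<tau>3 \<tau>4 :: complex.
        (\<forall>f x. x \<noteq> 0 \<longrightarrow>
           W_op q a b c \<tau>0 \<tau>1 \<tau>2 \<tau>3 \<tau>4 f x =
           qdiff_op q (W_A1 q a b c \<tau>1 \<tau>2 \<tau>4) (W_A2 q a c \<tau>1 \<tau>2 \<tau>4)
             (W_A0 q a b c \<tau>0 \<tau>1 \<tau>2 \<tau>3 \<tau>4) f x))
     \<and>
     (\<forall>a b c \<tau>0 \<tau>1 \<tau>2 \<tau>3 \<tau>4 :: complex. \<exists>p1 p2 p3.
        degree p1 \<le> 1 \<and> degree p2 \<le> 2 \<and> degree p3 \<le> 3 \<and> poly p3 1 = 0 \<and>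
        (\<forall>x. x \<noteq> 0 \<longrightarrow>
           W_A1 q a b c \<tau>1 \<tau>2 \<tau>4 x = big_A1 p3 x \<and>
           W_A2 q a c \<tau>1 \<tau>2 \<tau>4 x = big_A2 q p2 p3 x \<and>
           W_A0 q a b c \<tau>0 \<tau>1 \<tau>2 \<tau>3 \<tau>4 x = big_A0 q p1 p2 p3 x) \<and>
        (\<forall>f x. x \<noteq> 0 \<longrightarrow>
           W_op q a b c \<tau>0 \<tau>1 \<tau>2 \<tau>3 \<tau>4 f x = big_q_Heun q p1 p2 p3 f x))
     \<and>
     (\<forall>p1 p2 p3 :: complex poly. \<forall>\<delta> :: complex.
        degree p1 \<le> 1 \<and> degree p2 \<le> 2 \<and> degree p3 \<le> 3 \<and>
        \<delta> \<noteq> 0 \<and> poly p3 \<delta> = 0 \<and> nondegenerate q p2 p3 \<longrightarrow>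
        (\<exists>a b c \<tau>0 \<tau>1 \<tau>2 \<tau>3 \<tau>4 :: complex.
           (\<forall>x. x \<noteq> 0 \<longrightarrow>
              big_A1 p3 (\<delta> * x) = W_A1 q a b c \<tau>1 \<tau>2 \<tau>4 x \<and>
              big_A2 q p2 p3 (\<delta> * x) = W_A2 q a c \<tau>1 \<tau>2 \<tau>4 x \<and>
              big_A0 q p1 p2 p3 (\<delta> * x) = W_A0 q a b c \<tau>0 \<tau>1 \<tau>2 \<tau>3 \<tau>4 x) \<and>
           (\<forall>f x. x \<noteq> 0 \<longrightarrow>
              scale_op \<delta> (big_q_Heun q p1 p2 p3) f x =
              W_op q a b c \<tau>0 \<tau>1 \<tau>2 \<tau>3 \<tau>4 f x)))
     \<and>
     (\<forall>a b \<tau>0 \<tau>1 \<tau>2 \<tau>3 \<tau>4 :: complex. \<exists>p1 p2 r2.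
        degree p1 \<le> 1 \<and> degree p2 \<le> 2 \<and> degree r2 \<le> 2 \<and>
        (\<forall>x. x \<noteq> 0 \<longrightarrow>
           W_A1 q a b 0 \<tau>1 \<tau>2 \<tau>4 x = little_A1 r2 x \<and>
           W_A2 q a 0 \<tau>1 \<tau>2 \<tau>4 x = little_A2 q p2 r2 x \<and>
           W_A0 q a b 0 \<tau>0 \<tau>1 \<tau>2 \<tau>3 \<tau>4 x = little_A0 q p1 p2 r2 x) \<and>
        (\<forall>f x. x \<noteq> 0 \<longrightarrow>
           W_op q a b 0 \<tau>0 \<tau>1 \<tau>2 \<tau>3 \<tau>4 f x = little_q_Heun q p1 p2 r2 f x))"
proof (intro conjI allI impI)
  fix a b c \<tau>0 \<tau>1 \<tau>2 \<tau>3 \<tau>4 x :: complex and f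
  assume "x \<noteq> 0"
  then show "W_op q a b c \<tau>0 \<tau>1 \<tau>2 \<tau>3 \<tau>4 f x =
    qdiff_op q (W_A1 q a b c \<tau>1 \<tau>2 \<tau>4) (W_A2 q a c \<tau>1 \<tau>2 \<tau>4)
      (W_A0 q a b c \<tau>0 \<tau>1 \<tau>2 \<tau>3 \<tau>4) f x"
    by (rule W_op_eq_qdiff_op[OF assms(1)])
next
  fix a b c \<tau>0 \<tau>1 \<tau>2 \<tau>3 \<tau>4 :: complex
  obtain p1 p2 p3 where p: "degree p1 \<le> 1" "degree p2 \<le> 2" "degree p3 \<le> 3" "poly p3 1 = 0"
    and A: "\<And>x. x \<noteq> 0 \<Longrightarrow> W_A1 q a b c \<tau>1 \<tau>2 \<tau>4 x = big_A1 p3 x"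
      "\<And>x. x \<noteq> 0 \<Longrightarrow> W_A2 q a c \<tau>1 \<tau>2 \<tau>4 x = big_A2 q p2 p3 x"
      "\<And>x. x \<noteq> 0 \<Longrightarrow> W_A0 q a b c \<tau>0 \<tau>1 \<tau>2 \<tau>3 \<tau>4 x = big_A0 q p1 p2 p3 x"
    using W_coefficients_big_q_Heun[OF assms(1)] by metis
  have "W_op q a b c \<tau>0 \<tau>1 \<tau>2 \<tau>3 \<tau>4 f x = big_q_Heun q p1 p2 p3 f x" if "x \<noteq> 0" for f x
    using that
    by (simp add: W_op_eq_qdiff_op[OF assms(1)] big_q_Heun_def qdiff_op_def A)
  with p A show "\<exists>p1 p2 p3.
        degree p1 \<le> 1 \<and> degree p2 \<le> 2 \<and> degree p3 \<le> 3 \<and> poly p3 1 = 0 \<and>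
        (\<forall>x. x \<noteq> 0 \<longrightarrow>
           W_A1 q a b c \<tau>1 \<tau>2 \<tau>4 x = big_A1 p3 x \<and>
           W_A2 q a c \<tau>1 \<tau>2 \<tau>4 x = big_A2 q p2 p3 x \<and>
           W_A0 q a b c \<tau>0 \<tau>1 \<tau>2 \<tau>3 \<tau>4 x = big_A0 q p1 p2 p3 x) \<and>
        (\<forall>f x. x \<noteq> 0 \<longrightarrow>
           W_op q a b c \<tau>0 \<tau>1 \<tau>2 \<tau>3 \<tau>4 f x = big_q_Heun q p1 p2 p3 f x)"
    by blast
next
  fix p1 p2 p3 :: "complex poly" and \<delta> :: complex
  assume H: "degree p1 \<le> 1 \<and> degree p2 \<le> 2 \<and> degree p3 \<le> 3 \<and>
    \<delta> \<noteq> 0 \<and> poly p3 \<delta> = 0 \<and> nondegenerate q p2 p3"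
  then obtain a b c \<tau>0 \<tau>1 \<tau>2 \<tau>3 \<tau>4 where
    A: "\<And>x. x \<noteq> 0 \<Longrightarrow> big_A1 p3 (\<delta> * x) = W_A1 q a b c \<tau>1 \<tau>2 \<tau>4 x"
      "\<And>x. x \<noteq> 0 \<Longrightarrow> big_A2 q p2 p3 (\<delta> * x) = W_A2 q a c \<tau>1 \<tau>2 \<tau>4 x"
      "\<And>x. x \<noteq> 0 \<Longrightarrow> big_A0 q p1 p2 p3 (\<delta> * x) = W_A0 q a b c \<tau>0 \<tau>1 \<tau>2 \<tau>3 \<tau>4 x"
    using big_q_Heun_coefficients_W[OF assms, of \<delta> p1 p2 p3] by metis
  have "scale_op \<delta> (big_q_Heun q p1 p2 p3) f x = W_op q a b c \<tau>0 \<tau>1 \<tau>2 \<tau>3 \<tau>4 f x"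
    if "x \<noteq> 0" for f x
    unfolding big_q_Heun_def W_op_eq_qdiff_op[OF assms(1) that]
    using that H by (subst scale_op_qdiff_op) (simp_all add: qdiff_op_def A)
  with A show "\<exists>a b c \<tau>0 \<tau>1 \<tau>2 \<tau>3 \<tau>4 :: complex.
           (\<forall>x. x \<noteq> 0 \<longrightarrow>
              big_A1 p3 (\<delta> * x) = W_A1 q a b c \<tau>1 \<tau>2 \<tau>4 x \<and>
              big_A2 q p2 p3 (\<delta> * x) = W_A2 q a c \<tau>1 \<tau>2 \<tau>4 x \<and>
              big_A0 q p1 p2 p3 (\<delta> * x) = W_A0 q a b c \<tau>0 \<tau>1 \<tau>2 \<tau>3 \<tau>4 x) \<and>
           (\<forall>f x. x \<noteq> 0 \<longrightarrow>
              scale_op \<delta> (big_q_Heun q p1 p2 p3) f x =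
              W_op q a b c \<tau>0 \<tau>1 \<tau>2 \<tau>3 \<tau>4 f x)"
    by blast
next
  fix a b \<tau>0 \<tau>1 \<tau>2 \<tau>3 \<tau>4 :: complex
  obtain p1 p2 p3 where p: "degree p1 \<le> 1" "degree p2 \<le> 2" "degree p3 \<le> 3"
      "poly p3 0 = a * 0 * q * \<tau>4"
    and A: "\<And>x. x \<noteq> 0 \<Longrightarrow> W_A1 q a b 0 \<tau>1 \<tau>2 \<tau>4 x = big_A1 p3 x"
      "\<And>x. x \<noteq> 0 \<Longrightarrow> W_A2 q a 0 \<tau>1 \<tau>2 \<tau>4 x = big_A2 q p2 p3 x"
      "\<And>x. x \<noteq> 0 \<Longrightarrow> W_A0 q a b 0 \<tau>0 \<tau>1 \<tau>2 \<tau>3 \<tau>4 x = big_A0 q p1 p2 p3 x"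
    using W_coefficients_big_q_Heun[OF assms(1)] by metis
  obtain r2 where r2: "p3 = pCons 0 r2"
    using p(4) by (cases p3) auto
  have deg: "degree r2 \<le> 2"
    using p(3) by (auto simp: r2 degree_pCons_eq_if split: if_splits)
  have A': "W_A1 q a b 0 \<tau>1 \<tau>2 \<tau>4 x = little_A1 r2 x"
      "W_A2 q a 0 \<tau>1 \<tau>2 \<tau>4 x = little_A2 q p2 r2 x"
      "W_A0 q a b 0 \<tau>0 \<tau>1 \<tau>2 \<tau>3 \<tau>4 x = little_A0 q p1 p2 r2 x" if "x \<noteq> 0" for x
    using A[OF that] by (simp_all add: r2 big_q_Heun_coefficients_little[OF that])
  have "W_op q a b 0 \<tau>0 \<tau>1 \<tau>2 \<tau>3 \<tau>4 f x = little_q_Heun q p1 p2 r2 f x" if "x \<noteq> 0" for f x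
    using that
    by (simp add: W_op_eq_qdiff_op[OF assms(1)] little_q_Heun_def qdiff_op_def A')
  with p(1,2) deg A' show "\<exists>p1 p2 r2.
        degree p1 \<le> 1 \<and> degree p2 \<le> 2 \<and> degree r2 \<le> 2 \<and>
        (\<forall>x. x \<noteq> 0 \<longrightarrow>
           W_A1 q a b 0 \<tau>1 \<tau>2 \<tau>4 x = little_A1 r2 x \<and>
           W_A2 q a 0 \<tau>1 \<tau>2 \<tau>4 x = little_A2 q p2 r2 x \<and>
           W_A0 q a b 0 \<tau>0 \<tau>1 \<tau>2 \<tau>3 \<tau>4 x = little_A0 q p1 p2 r2 x) \<and>
        (\<forall>f x. x \<noteq> 0 \<longrightarrow>
           W_op q a b 0 \<tau>0 \<tau>1 \<tau>2 \<tau>3 \<tau>4 f x = little_q_Heun q p1 p2 r2 f x)"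
    by blast
qed

end
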